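(* Let $E$ be a finite-dimensional evolution algebra over a field $\mathbb{K}$ with natural basis $\mathcal{B}=\{e_1,\ldots,e_n\}$ and structural constants $a_{ij}$. Suppose $E$ is symmetric, meaning $a_{ij}=a_{ji}$ for all $i\neq j$. If $E$ is an $h$-EEA (with respect to $\mathcal{B}$) for some real $h>0$, then $E$ is simple as an evolution algebra.
   Context: An evolution algebra over $\mathbb{K}$ (finite-dimensional) is an algebra $E$ with a linear basis $\mathcal{B}=\{e_1,\dots,e_n\}$ (a natural basis) such that $e_ie_j=0$ for $i\neq j$ and $e_i^2=\sum_k a_{ik}e_k$ with $a_{ik}\in\mathbb{K}$; $A=(a_{ik})$ is the structural matrix. A subspace $E'\subseteq E$ is an evolution subalgebra if it has a natural basis $\{e_i\}_{i\in S}$ that extends to a natural basis of $E$; in the convention used, every evolution subalgebra is a two-sided ideal, called an evolution ideal. $E$ is simple if it has no proper evolution ideal (proper: different from $0$ and $E$). The graph $\Gamma(E,\mathcal{B})$ is the simple graph with vertex set $\{1,\dots,n\}$ and edges $\{i,j\}$, $i\ne j$, whenever $a_{ij}\neq0$ or $a_{ji}\ne0$. For a finite simple graph $\Gamma$ with vertex set $V$ and $W\subseteq V$, let $E(W)$ be the set of edges with exactly one endpoint in $W$; the Cheeger constant is $\mathfrak{h}(\Gamma)=\min\{|E(W)|/|W| : \emptyset\ne W\subsetneq V,\ |W|\le |V|/2\}$, with $\mathfrak{h}(\Gamma)=+\infty$ if $|V|\le1$. Put $\mathfrak{h}(E,\mathcal{B})=\mathfrak{h}(\Gamma(E,\mathcal{B}))$.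 For a real $h>0$, $E$ is an $h$-EEA ($h$-Expander Evolution Algebra) if $\mathfrak{h}(E,\mathcal{B})\ge h$.
   Formalization: Simplicity is taken relative to the fixed natural basis B: evolution ideals are spanned by subsets of B. If their basis may extend to any natural basis of E, the claim fails: over Q with e_1^2=e_2^2=e_1+e_2, the span of e_1+e_2 is a proper evolution ideal. *)

theory Defs
  imports Complex_Main "HOL-Library.Extended_Real"
begin

text \<open>The underlying vector space is the whole type \<open>'a\<close>; neither associativity nor
  commutativity is assumed.\<close>

locale bilinear_algebra = vector_space scale
  for scale :: "'k::field \<Rightarrow> 'a::ab_group_add \<Rightarrow> 'a" (infixr \<open>*s\<close> 75) +
  fixes mult :: "'a \<Rightarrow> 'a \<Rightarrow> 'a"  (infixl \<open>\<cdot>\<close> 70)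
  assumes linear_mult_right: "Vector_Spaces.linear scale scale (\<lambda>y. x \<cdot> y)"
    and linear_mult_left: "Vector_Spaces.linear scale scale (\<lambda>x. x \<cdot> y)"
begin

text \<open>\<open>natural_basis V C\<close>: the subspace \<open>V\<close> is itself an evolution algebra with natural
  basis \<open>C\<close>; in particular \<open>V\<close> contains the squares of the elements of \<open>C\<close>.\<close>

definition natural_basis :: "'a set \<Rightarrow> 'a set \<Rightarrow> bool" where
  "natural_basis V C \<longleftrightarrow>
     finite C \<and> independent C \<and> span C = V \<and>
     (\<forall>x\<in>C. \<forall>y\<in>C. x \<noteq> y \<longrightarrow> x \<cdot> y = 0) \<and> (\<forall>x\<in>C. x \<cdot> x \<in> V)"

text \<open>The notions below refer to a fixed natural basis \<open>B = {e\<^sub>1, \<dots>, e\<^sub>n}\<close> of the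
  algebra: the natural basis \<open>{e\<^sub>i : i \<in> S}\<close> of an evolution subalgebra extends to \<open>B\<close>.
  If it were only required to extend to some other natural basis, there would be more
  subalgebras, and a symmetric expander need not be simple: for \<open>e\<^sub>1\<^sup>2 = e\<^sub>2\<^sup>2 = e\<^sub>1 + e\<^sub>2\<close> over
  the rationals, \<open>{e\<^sub>1 + e\<^sub>2, e\<^sub>1 - e\<^sub>2}\<close> is another natural basis, and \<open>e\<^sub>1 + e\<^sub>2\<close> spans an
  ideal.\<close>

definition evolution_subalgebra :: "'a set \<Rightarrow> 'a set \<Rightarrow> bool" where
  "evolution_subalgebra B V \<longleftrightarrow>
     natural_basis UNIV B \<and> (\<exists>C. C \<subseteq> B \<and> natural_basis V C)"

definition two_sided_ideal :: "'a set \<Rightarrow> bool" where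
  "two_sided_ideal V \<longleftrightarrow> subspace V \<and> (\<forall>x\<in>V. \<forall>y. x \<cdot> y \<in> V \<and> y \<cdot> x \<in> V)"

definition evolution_ideal :: "'a set \<Rightarrow> 'a set \<Rightarrow> bool" where
  "evolution_ideal B V \<longleftrightarrow> evolution_subalgebra B V \<and> two_sided_ideal V"

definition evolution_simple :: "'a set \<Rightarrow> bool" where
  "evolution_simple B \<longleftrightarrow> (\<forall>V. evolution_ideal B V \<longrightarrow> V = {0} \<or> V = UNIV)"

lemma evolution_subalgebra_imp_ideal:
  assumes "evolution_subalgebra B V"
  shows "two_sided_ideal V"
proof -
  obtain C where B: "natural_basis UNIV B" and CB: "C \<subseteq> B" and C: "natural_basis V C"
    using assms by (auto simp: evolution_subalgebra_def)
  have V: "subspace V" "span C = V"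
    using C by (auto simp: natural_basis_def)
  interpret L: Vector_Spaces.linear scale scale "\<lambda>x. x \<cdot> y" for y
    by (rule linear_mult_left)
  interpret R: Vector_Spaces.linear scale scale "\<lambda>y. x \<cdot> y" for x
    by (rule linear_mult_right)
  note bilin = L.zero L.add L.scale R.zero R.add R.scale
  have step: "x \<cdot> b \<in> V \<and> b \<cdot> x \<in> V" if "x \<in> C" "b \<in> B" for x b
    using that B C CB V(1) subspace_0 unfolding natural_basis_def by (cases "x = b") auto
  have step2: "x \<cdot> y \<in> V \<and> y \<cdot> x \<in> V" if "x \<in> C" for x y
  proof -
    have "y \<in> span B"
      using B by (simp add: natural_basis_def)
    then show ?thesis
      by (induction rule: span_induct_alt)
        (use that V(1) step in \<open>auto simp: bilin subspace_0 subspace_add subspace_scale\<close>)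
  qed
  have "x \<cdot> y \<in> V \<and> y \<cdot> x \<in> V" if "x \<in> V" for x y
  proof -
    have "x \<in> span C"
      using that V(2) by simp
    then show ?thesis
      by (induction rule: span_induct_alt)
        (use V(1) step2 in \<open>auto simp: bilin subspace_0 subspace_add subspace_scale\<close>)
  qed
  then show ?thesis
    using V(1) by (simp add: two_sided_ideal_def)
qed

end

locale evolution_algebra = bilinear_algebra scale mult
  for scale :: "'k::field \<Rightarrow> 'a::ab_group_add \<Rightarrow> 'a" (infixr \<open>*s\<close> 75)
    and mult :: "'a \<Rightarrow> 'a \<Rightarrow> 'a"  (infixl \<open>\<cdot>\<close> 70) +
  fixes n :: nat and e :: "nat \<Rightarrow> 'a" and a :: "nat \<Rightarrow> nat \<Rightarrow> 'k"
  assumes inj_basis: "inj_on e {1..n}"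
    and natural_basis: "natural_basis UNIV (e ` {1..n})"
    and square: "i \<in> {1..n} \<Longrightarrow> e i \<cdot> e i = (\<Sum>k = 1..n. a i k *s e k)"

text \<open>A finite simple graph is given by its vertex set and its set of two-element edges.\<close>

definition edge_boundary :: "'v set set \<Rightarrow> 'v set \<Rightarrow> 'v set set" where
  "edge_boundary Es W = {d \<in> Es. card (d \<inter> W) = 1}"

definition cheeger_constant :: "'v set \<Rightarrow> 'v set set \<Rightarrow> ereal" where
  "cheeger_constant V Es =
     (if card V \<le> 1 then \<infinity>
      else Min {ereal (real (card (edge_boundary Es W)) / real (card W)) | W.
                W \<noteq> {} \<and> W \<subset> V \<and> real (card W) \<le> real (card V) / 2})"

definition evolution_edges :: "nat \<Rightarrow> (nat \<Rightarrow> nat \<Rightarrow> 'k::field) \<Rightarrow> nat set set" where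
  "evolution_edges n a =
     {{i, j} | i j. i \<in> {1..n} \<and> j \<in> {1..n} \<and> i \<noteq> j \<and> (a i j \<noteq> 0 \<or> a j i \<noteq> 0)}"

text \<open>\<open>is_EEA h n a\<close> is meant for the structural constants \<open>a\<close> of an evolution algebra with
  respect to a natural basis with \<open>n\<close> elements.\<close>

definition is_EEA :: "real \<Rightarrow> nat \<Rightarrow> (nat \<Rightarrow> nat \<Rightarrow> 'k::field) \<Rightarrow> bool" where
  "is_EEA h n a \<longleftrightarrow> 0 < h \<and> ereal h \<le> cheeger_constant {1..n} (evolution_edges n a)"

end

theory Submission
  imports Defs
begin

text \<open>If \<open>{e\<^sub>i : i \<in> S}\<close> spans an evolution subalgebra, then the squares \<open>e\<^sub>i\<^sup>2\<close> with \<open>i \<in> S\<close>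
  stay in its span, so \<open>a\<^sub>i\<^sub>k = 0\<close> for \<open>i \<in> S\<close> and \<open>k \<notin> S\<close>. By symmetry no edge of the graph
  joins \<open>S\<close> to its complement. If \<open>S\<close> were neither empty nor everything, the smaller of the two
  parts would be an admissible set with empty boundary, and the Cheeger constant would vanish.\<close>

text \<open>The quotient of \<open>W\<close> is one of the finitely many values over which the
  minimum is taken.\<close>

lemma cheeger_constant_le:
  assumes "finite V" "W \<noteq> {}" "W \<subset> V" "2 * card W \<le> card V"
  shows "cheeger_constant V Es \<le> ereal (real (card (edge_boundary Es W)) / real (card W))"
proof -
  have "card W > 0"
    using assms by (meson card_gt_0_iff finite_subset psubset_imp_subset)
  \<comment> \<open>A nonempty \<open>W\<close> filling at most half of \<open>V\<close> forces two
    vertices, so the value \<infinity> is excluded.\<close>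
  then have "\<not> card V \<le> 1"
    using assms(4) by linarith
  moreover have "Min {ereal (real (card (edge_boundary Es W)) / real (card W)) | W.
                W \<noteq> {} \<and> W \<subset> V \<and> real (card W) \<le> real (card V) / 2}
      \<le> ereal (real (card (edge_boundary Es W)) / real (card W))"
  proof (rule Min_le)
    have "finite {W. W \<noteq> {} \<and> W \<subset> V \<and> real (card W) \<le> real (card V) / 2}"
      by (rule finite_subset[of _ "Pow V"]) (use assms(1) in auto)
    then show "finite {ereal (real (card (edge_boundary Es W)) / real (card W)) | W.
                W \<noteq> {} \<and> W \<subset> V \<and> real (card W) \<le> real (card V) / 2}"
      by (rule finite_image_set)
    have "real (card W) \<le> real (card V) / 2"
      using assms(4) by linarith
    then show "ereal (real (card (edge_boundary Es W)) / real (card W)) \<in>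
        {ereal (real (card (edge_boundary Es W)) / real (card W)) | W.
                W \<noteq> {} \<and> W \<subset> V \<and> real (card W) \<le> real (card V) / 2}"
      using assms by blast
  qed
  ultimately show ?thesis
    by (simp add: cheeger_constant_def)
qed

text \<open>Both boundaries are assumed empty because \<open>Es\<close> is an arbitrary family of
  sets, for which the boundaries of \<open>S\<close> and \<open>V - S\<close> can differ.\<close>

lemma cheeger_constant_disconnected:
  assumes "finite V" "S \<noteq> {}" "S \<subset> V" "edge_boundary Es S = {}" "edge_boundary Es (V - S) = {}"
  shows "cheeger_constant V Es \<le> 0"
proof (cases "2 * card S \<le> card V")
  case True
  then show ?thesis
    using cheeger_constant_le[of V S Es] assms by (simp add: zero_ereal_def)
next
  case False
  moreover have "card (V - S) = card V - card S"
    using assms by (meson card_Diff_subset finite_subset psubset_imp_subset)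
  ultimately have "2 * card (V - S) \<le> card V"
    by linarith
  then show ?thesis
    using cheeger_constant_le[of V "V - S" Es] assms by (auto simp: zero_ereal_def)
qed

lemma edge_boundary_evolution_edges_empty:
  assumes "\<And>i j. i \<in> {1..n} \<inter> W \<Longrightarrow> j \<in> {1..n} - W \<Longrightarrow> a i j = 0 \<and> a j i = 0"
  shows "edge_boundary (evolution_edges n a) W = {}"
proof -
  have "card ({i, j} \<inter> W) \<noteq> 1"
    if "i \<in> {1..n}" "j \<in> {1..n}" "i \<noteq> j" "a i j \<noteq> 0 \<or> a j i \<noteq> 0" for i j
    \<comment> \<open>An edge meeting \<open>W\<close> in one point has one endpoint inside and one
      outside; either \<open>i\<close> or \<open>j\<close> may be the inner one.\<close>
    using that assms[of i j] assms[of j i] by (cases "i \<in> W"; cases "j \<in> W") auto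
  then show ?thesis
    by (auto simp: edge_boundary_def evolution_edges_def)
qed

context vector_space
begin

text \<open>If \<open>c j\<close> were nonzero, subtracting the other terms and dividing by
  \<open>c j\<close> would put \<open>e j\<close> in the span of the remaining basis
  vectors.\<close>

lemma coeff_eq_0_if_in_span:
  assumes "finite I" "inj_on e I" "independent (e ` I)" "S \<subseteq> I" "j \<in> I - S"
    and "(\<Sum>k\<in>I. c k *s e k) \<in> span (e ` S)"
  shows "c j = 0"
proof (rule ccontr)
  assume "c j \<noteq> 0"
  let ?R = "e ` I - {e j}"
  \<comment> \<open>By injectivity, deleting the vector \<open>e j\<close> loses no index except
    \<open>j\<close>.\<close>
  have R: "e k \<in> ?R" if "k \<in> I - {j}" for k
    using that assms(2,5) by (auto dest: inj_onD)
  have "e ` S \<subseteq> ?R"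
  proof (rule image_subsetI)
    show "e k \<in> ?R" if "k \<in> S" for k
      by (rule R) (use that assms(4,5) in auto)
  qed
  from subsetD[OF span_mono[OF this] assms(6)]
  have "(\<Sum>k\<in>I. c k *s e k) \<in> span ?R" .
  moreover have "(\<Sum>k\<in>I - {j}. c k *s e k) \<in> span ?R"
    using R by (intro span_sum span_scale span_base)
  ultimately have "(\<Sum>k\<in>I. c k *s e k) - (\<Sum>k\<in>I - {j}. c k *s e k) \<in> span ?R"
    by (rule span_diff)
  then have "c j *s e j \<in> span ?R"
    using assms(1,5) by (simp add: sum.remove[of I j])
  then have "inverse (c j) *s c j *s e j \<in> span ?R"
    by (rule span_scale)
  then have "e j \<in> span ?R"
    using \<open>c j \<noteq> 0\<close> by simp
  then show False
    using assms(3,5) unfolding dependent_def by blast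
qed

end

context evolution_algebra
begin

lemma coeff_eq_0_if_subalgebra:
  assumes "S \<subseteq> {1..n}" "natural_basis (span (e ` S)) (e ` S)" "i \<in> S" "k \<in> {1..n} - S"
  shows "a i k = 0"
proof (rule coeff_eq_0_if_in_span[where c = "a i" and j = k])
  show "independent (e ` {1..n})"
    using natural_basis by (simp add: natural_basis_def)
  have "e i \<cdot> e i \<in> span (e ` S)"
    using assms(2,3) by (auto simp: natural_basis_def)
  then show "(\<Sum>k\<in>{1..n}. a i k *s e k) \<in> span (e ` S)"
    using square assms(1,3) by auto
qed (use assms inj_basis in auto)

text \<open>Positivity of the Cheeger constant enters as connectedness: no proper nonempty
  \<open>S\<close> is cut off from its complement.\<close>

lemma evolution_simple_if_cheeger_pos:
  assumes sym: "\<forall>i\<in>{1..n}. \<forall>j\<in>{1..n}. i \<noteq> j \<longrightarrow> a i j = a j i"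
    and pos: "0 < cheeger_constant {1..n} (evolution_edges n a)"
  shows "evolution_simple (e ` {1..n})"
  unfolding evolution_simple_def
proof (intro allI impI)
  fix V
  assume "evolution_ideal (e ` {1..n}) V"
  then obtain C where C: "C \<subseteq> e ` {1..n}" "natural_basis V C"
    by (auto simp: evolution_ideal_def evolution_subalgebra_def)
  then obtain S where S: "S \<subseteq> {1..n}" "C = e ` S"
    by (auto simp: subset_image_iff)
  have V: "V = span (e ` S)"
    using C S by (simp add: natural_basis_def)
  have zero: "a i k = 0 \<and> a k i = 0" if "i \<in> S" "k \<in> {1..n} - S" for i k
  proof -
    have "natural_basis (span (e ` S)) (e ` S)"
      using C(2) unfolding S(2) V .
    then have "a i k = 0"
      by (rule coeff_eq_0_if_subalgebra[OF S(1) _ that])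
    \<comment> \<open>Closure under squares only controls the rows indexed by \<open>S\<close>;
      symmetry transfers the vanishing to the entries from outside into \<open>S\<close>.\<close>
    moreover have "a k i = a i k"
      by (rule sym[rule_format]) (use that S(1) in auto)
    ultimately show ?thesis
      by simp
  qed
  have "edge_boundary (evolution_edges n a) S = {}"
    by (rule edge_boundary_evolution_edges_empty) (use zero in auto)
  moreover have "edge_boundary (evolution_edges n a) ({1..n} - S) = {}"
    by (rule edge_boundary_evolution_edges_empty) (use zero S(1) in auto)
  ultimately have "S = {} \<or> S = {1..n}"
    using cheeger_constant_disconnected[of "{1..n}" S "evolution_edges n a"] pos S(1)
    by (meson finite_atLeastAtMost not_le psubsetI)
  \<comment> \<open>The empty \<open>S\<close> spans \<open>{0}\<close>, the full index set spans
    everything.\<close>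
  then show "V = {0} \<or> V = UNIV"
    using V natural_basis by (auto simp: natural_basis_def)
qed

end

theorem theorem3p8:
  fixes scale :: "'k::field \<Rightarrow> 'a::ab_group_add \<Rightarrow> 'a"
    and mult :: "'a \<Rightarrow> 'a \<Rightarrow> 'a"
    and n :: nat and e :: "nat \<Rightarrow> 'a" and a :: "nat \<Rightarrow> nat \<Rightarrow> 'k"
    and h :: real
  assumes "evolution_algebra scale mult n e a"
    and "\<forall>i\<in>{1..n}. \<forall>j\<in>{1..n}. i \<noteq> j \<longrightarrow> a i j = a j i"
    and "h > 0"
    and "is_EEA h n a"
  shows "bilinear_algebra.evolution_simple scale mult (e ` {1..n})"
proof -
  have "0 < ereal h"
    using assms(3) by simp
  also have "\<dots> \<le> cheeger_constant {1..n} (evolution_edges n a)"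
    using assms(4) by (simp add: is_EEA_def)
  finally show ?thesis
    using evolution_algebra.evolution_simple_if_cheeger_pos[OF assms(1,2)] by blast
qed

end
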